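(* Let $(S,+)$ be a semigroup (not necessarily commutative). Then the collection of all finite FS-big subsets of $S$ is partition regular: if $A\subseteq S$ is finite FS-big and $A=\bigcup_{i=1}^r B_i$ for some $r\in\mathbb{N}$, then some $B_i$ is finite FS-big.
   Context: For a finite sequence $\langle x_t\rangle_{t=1}^k$ in $S$ and a nonempty $F\subseteq\{1,\dots,k\}$, $\sum_{t\in F}x_t$ denotes the sum of the $x_t$, $t\in F$, taken in increasing order of indices. The sequence satisfies uniqueness of finite sums if whenever $F,H$ are nonempty subsets of $\{1,\dots,k\}$ with $\sum_{t\in F}x_t=\sum_{t\in H}x_t$, then $F=H$. A subset $A\subseteq S$ is $k$-summable if there is a sequence $\langle x_t\rangle_{t=1}^k$ in $S$ satisfying uniqueness of finite sums with $\sum_{t\in F}x_t\in A$ for every nonempty $F\subseteq\{1,\dots,k\}$. $A$ is finite FS-big if it is $k$-summable for every positive integer $k$. A collection $\mathcal S$ of sets is partition regular if whenever $A\in\mathcal S$ is partitioned into finitely many sets, at least one of them belongs to $\mathcal S$. *)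

theory Defs
  imports Main "HOL-Library.Disjoint_Sets"
begin

text \<open>A semigroup need not have a neutral element, so the sum starts from the term with the
  smallest index; it is meaningful only for finite nonempty \<open>F\<close>.\<close>

definition ordered_sum :: "(nat \<Rightarrow> 'a::semigroup_add) \<Rightarrow> nat set \<Rightarrow> 'a" where
  "ordered_sum x F =
     (let ts = sorted_list_of_set F in foldl (\<lambda>s t. s + x t) (x (hd ts)) (tl ts))"

text \<open>A finite sequence of length \<open>k\<close> is represented by a function on \<open>nat\<close> of which only the
  values at \<open>1, \<dots>, k\<close> are used.\<close>

definition unique_finite_sums :: "nat \<Rightarrow> (nat \<Rightarrow> 'a::semigroup_add) \<Rightarrow> bool" where
  "unique_finite_sums k x \<longleftrightarrow>
     (\<forall>F H. F \<noteq> {} \<longrightarrow> F \<subseteq> {1..k} \<longrightarrow> H \<noteq> {} \<longrightarrow> H \<subseteq> {1..k} \<longrightarrow>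
        ordered_sum x F = ordered_sum x H \<longrightarrow> F = H)"

definition k_summable :: "nat \<Rightarrow> 'a::semigroup_add set \<Rightarrow> bool" where
  "k_summable k A \<longleftrightarrow>
     (\<exists>x. unique_finite_sums k x \<and>
        (\<forall>F. F \<noteq> {} \<longrightarrow> F \<subseteq> {1..k} \<longrightarrow> ordered_sum x F \<in> A))"

definition finite_FS_big :: "'a::semigroup_add set \<Rightarrow> bool" where
  "finite_FS_big A \<longleftrightarrow> (\<forall>k\<ge>1. k_summable k A)"

definition partition_regular :: "'a set set \<Rightarrow> bool" where
  "partition_regular \<S> \<longleftrightarrow>
     (\<forall>A\<in>\<S>. \<forall>P. finite P \<longrightarrow> partition_on A P \<longrightarrow> (\<exists>B\<in>P. B \<in> \<S>))"

end

theory Submission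
  imports Defs "HOL-Library.Ramsey"
begin

text \<open>
  Colour a nonempty set of indices by a part of the partition that contains the corresponding sum.
  It suffices to find blocks \<open>D\<^sub>1 < \<dots> < D\<^sub>k\<close> all of whose unions have the same colour: the sums
  over these blocks form the required sequence, without any use of commutativity. By Ramsey's
  theorem we may assume that the colour of a set depends only on its cardinality, so that Hilbert's
  cube lemma provides the sizes of blocks \<open>E\<^sub>0 < \<dots> < E\<^sub>m\<close> such that every union involving \<open>E\<^sub>m\<close>
  has the colour of \<open>E\<^sub>m\<close>. Iterating this on the unions of the other blocks yields arbitrarily many
  blocks such that the colour of a union depends only on its last block, and the pigeonhole
  principle finishes the proof.
\<close>

section \<open>Ordered blocks\<close>

definition ordered_blocks :: "'a::linorder set \<Rightarrow> 'i::linorder set \<Rightarrow> ('i \<Rightarrow> 'a set) \<Rightarrow> bool" where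
  "ordered_blocks V I D \<longleftrightarrow>
     (\<forall>i\<in>I. finite (D i) \<and> D i \<noteq> {} \<and> D i \<subseteq> V) \<and>
     (\<forall>i\<in>I. \<forall>j\<in>I. i < j \<longrightarrow> (\<forall>a\<in>D i. \<forall>b\<in>D j. a < b))"

lemma ordered_blocksD:
  assumes "ordered_blocks V I D" "i \<in> I"
  shows "finite (D i)" "D i \<noteq> {}" "D i \<subseteq> V"
  using assms by (auto simp: ordered_blocks_def)

lemma ordered_blocks_less:
  assumes "ordered_blocks V I D" "i \<in> I" "j \<in> I" "i < j" "a \<in> D i" "b \<in> D j"
  shows "a < b"
  using assms unfolding ordered_blocks_def by blast

lemma ordered_blocks_UN_subset:
  assumes "ordered_blocks V K D" "I \<subseteq> K"
  shows "\<Union>(D ` I) \<subseteq> V"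
  using ordered_blocksD(3)[OF assms(1)] assms(2) by blast

lemma ordered_blocks_UN_nonempty:
  assumes "ordered_blocks V K D" "I \<subseteq> K" "I \<noteq> {}"
  shows "\<Union>(D ` I) \<noteq> {}"
  using ordered_blocksD(2)[OF assms(1)] assms(2,3) by blast

lemma ordered_blocks_mono:
  assumes "ordered_blocks V I D" "V \<subseteq> W"
  shows "ordered_blocks W I D"
  using assms unfolding ordered_blocks_def by blast

lemma ordered_blocks_reindex:
  assumes "ordered_blocks V I D" "strict_mono_on J f" "f ` J \<subseteq> I"
  shows "ordered_blocks V J (\<lambda>j. D (f j))"
  using assms unfolding ordered_blocks_def strict_mono_on_def by blast

lemma ordered_blocks_UN:
  assumes E: "ordered_blocks V J E" and D: "ordered_blocks J I D"
  shows "ordered_blocks V I (\<lambda>i. \<Union>(E ` D i))"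
  unfolding ordered_blocks_def
proof (intro conjI ballI impI)
  fix i assume i: "i \<in> I"
  note Di = ordered_blocksD[OF D i]
  show "finite (\<Union>(E ` D i))"
    using Di(1,3) ordered_blocksD(1)[OF E] by blast
  show "\<Union>(E ` D i) \<noteq> {}" using E Di(3,2) by (rule ordered_blocks_UN_nonempty)
  show "\<Union>(E ` D i) \<subseteq> V" using E Di(3) by (rule ordered_blocks_UN_subset)
next
  fix i j a b
  assume ij: "i \<in> I" "j \<in> I" "i < j" and "a \<in> \<Union>(E ` D i)" "b \<in> \<Union>(E ` D j)"
  then obtain s t where s: "s \<in> D i" "a \<in> E s" and t: "t \<in> D j" "b \<in> E t" by blast
  have "s < t" using D ij s(1) t(1) by (rule ordered_blocks_less)
  moreover have "s \<in> J" "t \<in> J" using ordered_blocksD(3)[OF D] ij s(1) t(1) by blast+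
  ultimately show "a < b" using ordered_blocks_less[OF E] s(2) t(2) by blast
qed

lemma ordered_blocks_append:
  assumes "ordered_blocks V {..<n} D" "finite A" "A \<noteq> {}" "A \<subseteq> V"
    and "\<And>i a b. \<lbrakk>i < n; a \<in> D i; b \<in> A\<rbrakk> \<Longrightarrow> a < b"
  shows "ordered_blocks V {..n} (D(n := A))"
  using assms unfolding ordered_blocks_def by (auto simp: order.strict_iff_order)

lemma ordered_blocks_UN_append:
  assumes E: "ordered_blocks V {..M} E" and D: "ordered_blocks {..<M} {..<m} D"
  shows "ordered_blocks V {..m} (\<lambda>i. \<Union>(E ` (D(m := {M})) i))"
  using E
proof (rule ordered_blocks_UN)
  show "ordered_blocks {..M} {..m} (D(m := {M}))"
  proof (rule ordered_blocks_append)
    show "ordered_blocks {..M} {..<m} D" using D by (rule ordered_blocks_mono) auto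
    show "a < b" if "i < m" "a \<in> D i" "b \<in> {M}" for i a b
      using ordered_blocksD(3)[OF D, of i] that by auto
  qed auto
qed

lemma ordered_blocks_disjoint:
  assumes "ordered_blocks V I D"
  shows "disjoint_family_on D I"
  unfolding disjoint_family_on_def
proof (intro ballI impI)
  fix i j assume "i \<in> I" "j \<in> I" "i \<noteq> j"
  consider (less) "i < j" | (greater) "j < i" using \<open>i \<noteq> j\<close> by (rule linorder_neqE)
  then show "D i \<inter> D j = {}"
  proof cases
    case less
    then show ?thesis
      using ordered_blocks_less[OF assms \<open>i \<in> I\<close> \<open>j \<in> I\<close>] by blast
  next
    case greater
    then show ?thesis
      using ordered_blocks_less[OF assms \<open>j \<in> I\<close> \<open>i \<in> I\<close>] by blast
  qed
qed

lemma card_UN_ordered_blocks: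
  assumes D: "ordered_blocks V K D" and I: "I \<subseteq> K" "finite I"
  shows "card (\<Union>(D ` I)) = (\<Sum>i\<in>I. card (D i))"
proof (rule card_UN_disjoint')
  show "disjoint_family_on D I"
    using I(1) ordered_blocks_disjoint[OF D] by (rule disjoint_family_on_mono)
  show "finite (D i)" if "i \<in> I" for i using ordered_blocksD(1)[OF D] I(1) that by blast
qed (rule I(2))

lemma ordered_blocks_UN_subsetD:
  assumes D: "ordered_blocks V K D" and "I \<subseteq> K" "J \<subseteq> K" "\<Union>(D ` I) \<subseteq> \<Union>(D ` J)"
  shows "I \<subseteq> J"
proof
  fix i assume "i \<in> I"
  then have "i \<in> K" using assms(2) by blast
  then obtain a where "a \<in> D i" using ordered_blocksD(2)[OF D] by blast
  then obtain j where "j \<in> J" "a \<in> D j" using \<open>i \<in> I\<close> assms(4) by blast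
  moreover have "D i \<inter> D j = {}" if "i \<noteq> j"
    using disjoint_family_onD[OF ordered_blocks_disjoint[OF D] \<open>i \<in> K\<close> _ that]
      \<open>j \<in> J\<close> assms(3) by blast
  ultimately show "i \<in> J" using \<open>a \<in> D i\<close> by blast
qed

lemma ordered_blocks_UN_inject:
  assumes D: "ordered_blocks V K D" and "I \<subseteq> K" "J \<subseteq> K" and eq: "\<Union>(D ` I) = \<Union>(D ` J)"
  shows "I = J"
proof
  show "I \<subseteq> J" by (rule ordered_blocks_UN_subsetD[OF D assms(2,3) equalityD1[OF eq]])
  show "J \<subseteq> I" by (rule ordered_blocks_UN_subsetD[OF D assms(3,2) equalityD2[OF eq]])
qed

lemma obtain_initial_segment:
  fixes H :: "'a::linorder set"
  assumes "finite H" "n \<le> card H"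
  obtains L where "L \<subseteq> H" "card L = n" "\<forall>a\<in>L. \<forall>b\<in>H - L. a < b"
proof
  let ?xs = "sorted_list_of_set H"
  have set_xs: "set (take n ?xs) \<union> set (drop n ?xs) = H"
    using assms(1) by (simp flip: set_append)
  show "set (take n ?xs) \<subseteq> H" using set_xs by blast
  show "card (set (take n ?xs)) = n"
    using assms by (simp add: distinct_card)
  have "sorted_wrt (<) (take n ?xs @ drop n ?xs)" by simp
  then have "\<forall>a\<in>set (take n ?xs). \<forall>b\<in>set (drop n ?xs). a < b"
    unfolding sorted_wrt_append by blast
  then show "\<forall>a\<in>set (take n ?xs). \<forall>b\<in>H - set (take n ?xs). a < b"
    using set_xs by blast
qed

lemma ordered_blocks_with_cards:
  fixes H :: "'a::linorder set" and s :: "nat \<Rightarrow> nat"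
  assumes "finite H" "sum s {..<m} \<le> card H" "\<And>i. i < m \<Longrightarrow> 0 < s i"
  shows "\<exists>D. ordered_blocks H {..<m} D \<and> (\<forall>i<m. card (D i) = s i)"
  using assms
proof (induction m arbitrary: H)
  case 0
  then show ?case by (simp add: ordered_blocks_def)
next
  case (Suc m)
  have "sum s {..<m} \<le> card H" using Suc.prems(2) by simp
  then obtain L where L: "L \<subseteq> H" "card L = sum s {..<m}" "\<forall>a\<in>L. \<forall>b\<in>H - L. a < b"
    using obtain_initial_segment[OF Suc.prems(1)] by blast
  then obtain D where D: "ordered_blocks L {..<m} D" "\<forall>i<m. card (D i) = s i"
    using Suc.IH[of L] Suc.prems finite_subset[OF L(1)] by auto
  have "s m \<le> card (H - L)"
    using Suc.prems L by (simp add: card_Diff_subset finite_subset)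
  then obtain A where A: "A \<subseteq> H - L" "card A = s m" "finite A"
    by (meson obtain_subset_with_card_n)
  have "ordered_blocks H {..m} (D(m := A))"
  proof (rule ordered_blocks_append)
    show "ordered_blocks H {..<m} D" using D(1) L(1) by (rule ordered_blocks_mono)
    show "A \<noteq> {}" using A(2) Suc.prems(3)[of m] by auto
    show "a < b" if "i < m" "a \<in> D i" "b \<in> A" for i a b
      using ordered_blocksD(3)[OF D(1), of i] that A(1) L(3) by blast
  qed (use A in auto)
  moreover have "\<forall>i<Suc m. card ((D(m := A)) i) = s i"
    using D(2) A(2) by (simp add: less_Suc_eq)
  ultimately show ?case unfolding lessThan_Suc_atMost by blast
qed

section \<open>The finite unions theorem for ordered blocks\<close>

definition unavoidable :: "'c set \<Rightarrow> ('a set \<Rightarrow> ('a set \<Rightarrow> 'c) \<Rightarrow> bool) \<Rightarrow> bool" where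
  "unavoidable C P \<longleftrightarrow>
     (\<exists>N. \<forall>V c. finite V \<longrightarrow> N \<le> card V \<longrightarrow> range c \<subseteq> C \<longrightarrow> P V c)"

lemma unavoidableI:
  assumes "\<And>V c. \<lbrakk>finite V; N \<le> card V; range c \<subseteq> C\<rbrakk> \<Longrightarrow> P V c"
  shows "unavoidable C P"
  using assms unfolding unavoidable_def by blast

subsection \<open>Colours determined by the cardinality\<close>

lemma partn_inj_image:
  assumes U: "partn U m k C" and g: "inj_on g U" "g ` U \<subseteq> V"
  shows "partn V m k C"
  unfolding partn_def
proof
  fix f assume f: "f \<in> nsets V k \<rightarrow> C"
  have "f \<circ> (`) g \<in> nsets U k \<rightarrow> C"
    using g by (intro nsets_compose_image_funcset[OF f]) auto
  then obtain q H where q: "q \<in> C" and H: "H \<in> nsets U m"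
    and mono: "(f \<circ> (`) g) ` nsets H k \<subseteq> {q}"
    using U unfolding partn_def monochromatic_def by meson
  have "g ` H \<in> nsets V m" using H nsets_image_funcset[of g U V m] g by blast
  moreover have "f ` nsets (g ` H) k \<subseteq> {q}"
  proof
    fix y assume "y \<in> f ` nsets (g ` H) k"
    then obtain X where X: "X \<in> nsets (g ` H) k" "y = f X" by blast
    have "inj_on g H" using g(1) H by (auto simp: nsets_def intro: inj_on_subset)
    with X(1) obtain Y where "Y \<in> nsets H k" "X = g ` Y" by (rule nset_image_obtains)
    then show "y \<in> {q}" using mono X(2) by auto
  qed
  ultimately show "\<exists>\<xi>\<in>C. monochromatic V m k f \<xi>"
    using q unfolding monochromatic_def by blast
qed

lemma partn_lst_replicate_imp_partn:
  assumes V: "partn_lst V (replicate (card C) m) k" and C: "finite C"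
  shows "partn V m k C"
  unfolding partn_def
proof
  fix f assume f: "f \<in> nsets V k \<rightarrow> C"
  obtain t where t: "bij_betw t C {..<card C}"
    using ex_bij_betw_finite_nat[OF C] by (auto simp: atLeast0LessThan)
  have "t \<circ> f \<in> nsets V k \<rightarrow> {..<card C}"
    using f bij_betw_imp_funcset[OF t] by (auto simp: Pi_iff)
  then obtain i H where i: "i < card C" and H: "H \<in> nsets V m"
    and mono: "(t \<circ> f) ` nsets H k \<subseteq> {i}"
    by (rule partn_lstE[OF V]) auto
  have "f X = inv_into C t i" if X: "X \<in> nsets H k" for X
  proof -
    have "X \<in> nsets V k" using X H nsets_mono[of H V k] by (auto simp: nsets_def)
    then have "f X \<in> C" using f by blast
    moreover have "t (f X) = i" using X mono by auto
    ultimately show ?thesis using t by (auto simp: bij_betw_def)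
  qed
  then have "monochromatic V m k f (inv_into C t i)"
    unfolding monochromatic_def using H by blast
  moreover have "inv_into C t i \<in> C" using t i by (auto simp: bij_betw_def intro: inv_into_into)
  ultimately show "\<exists>\<xi>\<in>C. monochromatic V m k f \<xi>" by blast
qed

lemma ramsey_partn:
  assumes "finite C"
  shows "\<exists>N. \<forall>V :: 'a set. finite V \<longrightarrow> N \<le> card V \<longrightarrow> partn V m k C"
proof -
  obtain N :: nat where "partn_lst {..<N} (replicate (card C) m) k"
    using ramsey_full by blast
  then have N: "partn {..<N} m k C" using assms by (rule partn_lst_replicate_imp_partn)
  have "partn V m k C" if V: "finite V" "N \<le> card V" for V :: "'a set"
  proof -
    obtain g where "inj_on g {..<N}" "g ` {..<N} \<subseteq> V"
      using V card_le_inj[of "{..<N}" V] by auto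
    then show ?thesis by (rule partn_inj_image[OF N])
  qed
  then show ?thesis by blast
qed

definition coloured_by_card :: "'c set \<Rightarrow> ('a set \<Rightarrow> 'c) \<Rightarrow> 'a set \<Rightarrow> nat \<Rightarrow> bool" where
  "coloured_by_card C c H K \<longleftrightarrow>
     (\<exists>\<chi>. range \<chi> \<subseteq> C \<and> (\<forall>F\<subseteq>H. card F \<le> K \<longrightarrow> c F = \<chi> (card F)))"

lemma coloured_by_card_0:
  assumes "range c \<subseteq> C" "finite H"
  shows "coloured_by_card C c H 0"
  unfolding coloured_by_card_def
proof (intro exI conjI allI impI)
  show "range (\<lambda>_ :: nat. c {}) \<subseteq> C" using assms(1) by blast
  show "c F = c {}" if "F \<subseteq> H" "card F \<le> 0" for F
    using that finite_subset[OF that(1) assms(2)] by simp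
qed

lemma coloured_by_card_Suc:
  assumes H: "coloured_by_card C c H K" "finite H"
    and q: "q \<in> C" "c ` nsets H (Suc K) \<subseteq> {q}"
  shows "coloured_by_card C c H (Suc K)"
proof -
  obtain \<chi> where \<chi>: "range \<chi> \<subseteq> C" and small: "\<And>F. \<lbrakk>F \<subseteq> H; card F \<le> K\<rbrakk> \<Longrightarrow> c F = \<chi> (card F)"
    using H(1) unfolding coloured_by_card_def by blast
  have "c F = q" if "F \<subseteq> H" "card F = Suc K" for F
  proof -
    have "F \<in> nsets H (Suc K)" using that H(2) by (auto simp: nsets_def intro: finite_subset)
    then show ?thesis using q(2) by blast
  qed
  then have "\<forall>F\<subseteq>H. card F \<le> Suc K \<longrightarrow> c F = (\<chi>(Suc K := q)) (card F)"
    using small by (simp add: le_Suc_eq)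
  moreover have "range (\<chi>(Suc K := q)) \<subseteq> C" using q(1) \<chi> by auto
  ultimately show ?thesis
    unfolding coloured_by_card_def by (intro exI[of _ "\<chi>(Suc K := q)"] conjI)
qed

lemma unavoidable_coloured_by_card:
  fixes C :: "'c set"
  assumes C: "finite C"
  shows "unavoidable C (\<lambda>(V :: 'a set) c. \<exists>H\<subseteq>V. card H = M \<and> coloured_by_card C c H K)"
proof (induction K)
  case 0
  show ?case
  proof (rule unavoidableI)
    fix V :: "'a set" and c :: "'a set \<Rightarrow> 'c"
    assume V: "finite V" "M \<le> card V" and c: "range c \<subseteq> C"
    obtain H where "H \<subseteq> V" "card H = M" "finite H"
      using obtain_subset_with_card_n[OF V(2)] by blast
    then show "\<exists>H\<subseteq>V. card H = M \<and> coloured_by_card C c H 0"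
      using coloured_by_card_0[OF c] by blast
  qed
next
  case (Suc K)
  obtain N where N: "\<And>(V :: 'a set) c. \<lbrakk>finite V; N \<le> card V; range c \<subseteq> C\<rbrakk> \<Longrightarrow>
     \<exists>H\<subseteq>V. card H = M \<and> coloured_by_card C c H K"
    using Suc.IH unfolding unavoidable_def by blast
  obtain N' where N': "\<And>V :: 'a set. \<lbrakk>finite V; N' \<le> card V\<rbrakk> \<Longrightarrow> partn V N (Suc K) C"
    using ramsey_partn[OF C] by blast
  show ?case
  proof (rule unavoidableI)
    fix V :: "'a set" and c :: "'a set \<Rightarrow> 'c"
    assume V: "finite V" "N' \<le> card V" and c: "range c \<subseteq> C"
    then have "c \<in> nsets V (Suc K) \<rightarrow> C" by auto
    then obtain q W where q: "q \<in> C" and W: "W \<in> nsets V N" "c ` nsets W (Suc K) \<subseteq> {q}"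
      using N'[OF V] unfolding partn_def monochromatic_def by meson
    then have "W \<subseteq> V" "finite W" "N \<le> card W" by (auto simp: nsets_def)
    then obtain H where H: "H \<subseteq> W" "card H = M" and "coloured_by_card C c H K"
      using N[OF _ _ c, of W] by blast
    moreover have "finite H" using H(1) \<open>finite W\<close> by (rule finite_subset)
    moreover have "c ` nsets H (Suc K) \<subseteq> {q}" using W(2) nsets_mono[OF H(1)] by blast
    ultimately have "coloured_by_card C c H (Suc K)" using q by (intro coloured_by_card_Suc)
    then show "\<exists>H\<subseteq>V. card H = M \<and> coloured_by_card C c H (Suc K)"
      using H \<open>W \<subseteq> V\<close> by blast
  qed
qed

subsection \<open>Hilbert's cube lemma\<close>

definition monochromatic_cube :: "(nat \<Rightarrow> 'c) \<Rightarrow> nat \<Rightarrow> nat \<Rightarrow> (nat \<Rightarrow> nat) \<Rightarrow> bool" where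
  "monochromatic_cube \<chi> m a d \<longleftrightarrow>
     0 < a \<and> (\<forall>i<m. 0 < d i) \<and> (\<forall>I\<subseteq>{..<m}. \<chi> (a + sum d I) = \<chi> a)"

lemma colouring_repeats_window:
  fixes \<chi> :: "nat \<Rightarrow> 'c"
  assumes "finite C" "range \<chi> \<subseteq> C"
  obtains x y where "x < y" "y \<le> card ({..N} \<rightarrow>\<^sub>E C)" "\<And>n. n \<le> N \<Longrightarrow> \<chi> (x + n) = \<chi> (y + n)"
proof -
  let ?P = "{..N} \<rightarrow>\<^sub>E C"
  define window where "window x = restrict (\<lambda>n. \<chi> (x + n)) {..N}" for x
  have "window x \<in> ?P" for x using assms(2) by (auto simp: window_def restrict_PiE_iff)
  then have "window ` {..card ?P} \<subseteq> ?P" by blast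
  then have "card (window ` {..card ?P}) \<le> card ?P"
    using assms(1) by (intro card_mono finite_PiE) auto
  then have "\<not> inj_on window {..card ?P}" by (intro pigeonhole) simp
  then obtain x y where xy: "x < y" "y \<le> card ?P" "window x = window y"
    by (metis atMost_iff linorder_inj_onI')
  have "\<chi> (x + n) = \<chi> (y + n)" if "n \<le> N" for n
    using fun_cong[OF xy(3), of n] that by (simp add: window_def)
  then show ?thesis using that xy(1,2) by blast
qed

lemma monochromatic_cube_Suc:
  assumes "x < y" and repeat: "\<And>n. n \<le> a + sum d {..<m} \<Longrightarrow> \<chi> (x + n) = \<chi> (y + n)"
    and cube: "monochromatic_cube (\<lambda>n. \<chi> (x + n)) m a d"
  shows "monochromatic_cube \<chi> (Suc m) (x + a) (d(m := y - x))"
proof -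
  let ?d = "d(m := y - x)"
  have "\<chi> (x + a + sum ?d I) = \<chi> (x + a)" if I: "I \<subseteq> {..<Suc m}" for I
  proof -
    have J: "I - {m} \<subseteq> {..<m}" using I by (auto simp: less_Suc_eq)
    have sum_J: "sum ?d (I - {m}) = sum d (I - {m})" by (intro sum.cong) auto
    have cube_J: "\<chi> (x + (a + sum d (I - {m}))) = \<chi> (x + a)"
      using cube J by (simp add: monochromatic_cube_def)
    show ?thesis
    proof (cases "m \<in> I")
      case True
      then have "sum ?d I = y - x + sum d (I - {m})"
        using sum.remove[OF finite_subset[OF I], of m ?d] sum_J by simp
      then have "\<chi> (x + a + sum ?d I) = \<chi> (y + (a + sum d (I - {m})))"
        using \<open>x < y\<close> by (simp add: algebra_simps)
      also have "\<dots> = \<chi> (x + (a + sum d (I - {m})))"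
        using sum_mono2[OF _ J, of d] by (intro repeat[symmetric]) simp
      finally show ?thesis using cube_J by simp
    next
      case False
      then show ?thesis using cube_J sum_J by (simp add: add.assoc)
    qed
  qed
  then show ?thesis
    using cube \<open>x < y\<close> by (auto simp: monochromatic_cube_def less_Suc_eq)
qed

lemma ex_monochromatic_cube:
  fixes C :: "'c set" and m :: nat
  assumes C: "finite C"
  shows "\<exists>N. \<forall>\<chi>. range \<chi> \<subseteq> C \<longrightarrow>
     (\<exists>a d. monochromatic_cube \<chi> m a d \<and> a + sum d {..<m} \<le> N)"
proof (induction m)
  case 0
  then show ?case by (auto simp: monochromatic_cube_def intro: exI[of _ 1])
next
  case (Suc m)
  then obtain N where N: "\<And>\<chi>. range \<chi> \<subseteq> C \<Longrightarrow>
     \<exists>a d. monochromatic_cube \<chi> m a d \<and> a + sum d {..<m} \<le> N"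
    by blast
  let ?L = "card ({..N} \<rightarrow>\<^sub>E C)"
  have "\<exists>a d. monochromatic_cube \<chi> (Suc m) a d \<and> a + sum d {..<Suc m} \<le> N + ?L"
    if \<chi>: "range \<chi> \<subseteq> C" for \<chi>
  proof -
    obtain x y where xy: "x < y" "y \<le> ?L" and repeat: "\<And>n. n \<le> N \<Longrightarrow> \<chi> (x + n) = \<chi> (y + n)"
      using colouring_repeats_window[OF C \<chi>] by blast
    have "range (\<lambda>n. \<chi> (x + n)) \<subseteq> C" using \<chi> by auto
    then obtain a d where cube: "monochromatic_cube (\<lambda>n. \<chi> (x + n)) m a d"
      and le: "a + sum d {..<m} \<le> N"
      using N by blast
    have "monochromatic_cube \<chi> (Suc m) (x + a) (d(m := y - x))"
      using xy(1) _ cube by (rule monochromatic_cube_Suc) (use le repeat in simp)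
    moreover have "sum (d(m := y - x)) {..<m} = sum d {..<m}" by (intro sum.cong) auto
    then have "x + a + sum (d(m := y - x)) {..<Suc m} \<le> N + ?L" using le xy by simp
    ultimately show ?thesis by blast
  qed
  then show ?case by blast
qed

subsection \<open>Colours determined by the last block\<close>

lemma ordered_blocks_of_monochromatic_cube:
  assumes H: "finite H" "\<And>F. F \<subseteq> H \<Longrightarrow> c F = \<chi> (card F)"
    and cube: "monochromatic_cube \<chi> m a d" "a + sum d {..<m} \<le> card H"
  shows "\<exists>D. ordered_blocks H {..m} D \<and> (\<forall>I\<subseteq>{..m}. m \<in> I \<longrightarrow> c (\<Union>(D ` I)) = c (D m))"
proof -
  define s where "s = d(m := a)"
  have sum_s: "sum s I = sum d I" if "I \<subseteq> {..<m}" for I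
    using that by (intro sum.cong) (auto simp: s_def)
  have "sum s {..<Suc m} \<le> card H" using cube(2) sum_s[of "{..<m}"] by (simp add: s_def)
  moreover have "0 < s i" if "i < Suc m" for i
    using that cube(1) by (auto simp: s_def monochromatic_cube_def less_Suc_eq)
  ultimately have "\<exists>D. ordered_blocks H {..<Suc m} D \<and> (\<forall>i<Suc m. card (D i) = s i)"
    by (rule ordered_blocks_with_cards[OF H(1)])
  then obtain D where D: "ordered_blocks H {..m} D" "\<forall>i\<le>m. card (D i) = s i"
    unfolding lessThan_Suc_atMost less_Suc_eq_le by blast
  have colour: "c (\<Union>(D ` I)) = \<chi> a" if I: "I \<subseteq> {..m}" "m \<in> I" for I
  proof -
    have J: "I - {m} \<subseteq> {..<m}" and "finite I" using I by (auto intro: finite_subset)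
    have "card (\<Union>(D ` I)) = sum s I"
      using card_UN_ordered_blocks[OF D(1) I(1) \<open>finite I\<close>] D(2) I(1) by (auto intro: sum.cong)
    also have "\<dots> = a + sum d (I - {m})"
      using sum.remove[OF \<open>finite I\<close> I(2), of s] sum_s[OF J] by (simp add: s_def)
    finally show ?thesis
      using H(2)[OF ordered_blocks_UN_subset[OF D(1) I(1)]] cube(1) J
      by (simp add: monochromatic_cube_def)
  qed
  then have "\<forall>I\<subseteq>{..m}. m \<in> I \<longrightarrow> c (\<Union>(D ` I)) = c (D m)"
    using colour[of "{m}"] by simp
  then show ?thesis using D(1) by blast
qed

lemma unavoidable_dominant_last_block:
  fixes C :: "'c set" and m :: nat
  assumes C: "finite C"
  shows "unavoidable C (\<lambda>(V :: 'a::linorder set) c. \<exists>D. ordered_blocks V {..m} D \<and>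
     (\<forall>I\<subseteq>{..m}. m \<in> I \<longrightarrow> c (\<Union>(D ` I)) = c (D m)))"
proof -
  obtain M where M: "\<And>\<chi>. range \<chi> \<subseteq> C \<Longrightarrow>
      \<exists>a d. monochromatic_cube \<chi> m a d \<and> a + sum d {..<m} \<le> M"
    using ex_monochromatic_cube[OF C, of m] by blast
  obtain N where N: "\<And>(V :: 'a set) c. \<lbrakk>finite V; N \<le> card V; range c \<subseteq> C\<rbrakk> \<Longrightarrow>
     \<exists>H\<subseteq>V. card H = M \<and> coloured_by_card C c H M"
    using unavoidable_coloured_by_card[OF C, of M M] unfolding unavoidable_def by blast
  show ?thesis
  proof (rule unavoidableI)
    fix V :: "'a set" and c :: "'a set \<Rightarrow> 'c"
    assume V: "finite V" "N \<le> card V" "range c \<subseteq> C"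
    obtain H \<chi> where H: "H \<subseteq> V" "card H = M" and \<chi>: "range \<chi> \<subseteq> C"
      and small: "\<And>F. \<lbrakk>F \<subseteq> H; card F \<le> M\<rbrakk> \<Longrightarrow> c F = \<chi> (card F)"
      using N[OF V] unfolding coloured_by_card_def by blast
    have "finite H" using H(1) V(1) by (rule finite_subset)
    then have c: "c F = \<chi> (card F)" if "F \<subseteq> H" for F
      using small[OF that] card_mono[OF _ that] H(2) by simp
    obtain a d where cube: "monochromatic_cube \<chi> m a d" "a + sum d {..<m} \<le> card H"
      using M[OF \<chi>] H(2) by blast
    obtain D where "ordered_blocks H {..m} D"
      and "\<forall>I\<subseteq>{..m}. m \<in> I \<longrightarrow> c (\<Union>(D ` I)) = c (D m)"
      using ordered_blocks_of_monochromatic_cube[OF \<open>finite H\<close> c cube] by blast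
    then show "\<exists>D. ordered_blocks V {..m} D \<and>
        (\<forall>I\<subseteq>{..m}. m \<in> I \<longrightarrow> c (\<Union>(D ` I)) = c (D m))"
      using ordered_blocks_mono[OF _ H(1)] by blast
  qed
qed

definition coloured_by_Max :: "('a set \<Rightarrow> 'c) \<Rightarrow> ('i::linorder \<Rightarrow> 'a set) \<Rightarrow> 'i set \<Rightarrow> bool" where
  "coloured_by_Max c D K \<longleftrightarrow> (\<forall>I\<subseteq>K. I \<noteq> {} \<longrightarrow> c (\<Union>(D ` I)) = c (D (Max I)))"

lemma coloured_by_Max_append:
  fixes D :: "nat \<Rightarrow> 'b set"
  assumes last: "\<And>F. F \<subseteq> W \<Longrightarrow> c (E b \<union> \<Union>(E ` F)) = c (E b)"
    and D: "coloured_by_Max (\<lambda>F. c (\<Union>(E ` F))) D {..<m}" "\<And>i. i < m \<Longrightarrow> D i \<subseteq> W"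
  shows "coloured_by_Max c (\<lambda>i. \<Union>(E ` (D(m := {b})) i)) {..m}"
  unfolding coloured_by_Max_def
proof (intro allI impI)
  fix I assume I: "I \<subseteq> {..m}" "I \<noteq> {}"
  let ?D = "\<lambda>i. \<Union>(E ` (D(m := {b})) i)"
  have "finite I" using I(1) by (rule finite_subset) simp
  have J: "I - {m} \<subseteq> {..<m}" using I(1) by (auto simp: order.strict_iff_order)
  have UN_J: "\<Union>(?D ` (I - {m})) = \<Union>(E ` \<Union>(D ` (I - {m})))" by auto
  show "c (\<Union>(?D ` I)) = c (?D (Max I))"
  proof (cases "m \<in> I")
    case True
    then have "Max I = m" using I(1) \<open>finite I\<close> by (intro Max_eqI) auto
    have "\<Union>(D ` (I - {m})) \<subseteq> W" using D(2) J by blast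
    moreover have "\<Union>(?D ` I) = ?D m \<union> \<Union>(?D ` (I - {m}))" using True by blast
    then have "\<Union>(?D ` I) = E b \<union> \<Union>(E ` \<Union>(D ` (I - {m})))" unfolding UN_J by simp
    ultimately have "c (\<Union>(?D ` I)) = c (E b)" by (simp only: last)
    then show ?thesis using \<open>Max I = m\<close> by simp
  next
    case False
    then have "I - {m} = I" by simp
    moreover have "Max I \<noteq> m" using False Max_in[OF \<open>finite I\<close> I(2)] by metis
    ultimately show ?thesis using D(1) I(2) J UN_J by (simp add: coloured_by_Max_def)
  qed
qed

lemma unavoidable_coloured_by_Max:
  fixes C :: "'c set" and m :: nat
  assumes C: "finite C"
  shows "unavoidable C (\<lambda>(V :: nat set) c.
     \<exists>D. ordered_blocks V {..<m} D \<and> coloured_by_Max c D {..<m})"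
proof (induction m)
  case 0
  show ?case
    by (rule unavoidableI) (simp add: ordered_blocks_def coloured_by_Max_def)
next
  case (Suc m)
  obtain M where M: "\<And>(V :: nat set) c. \<lbrakk>finite V; M \<le> card V; range c \<subseteq> C\<rbrakk> \<Longrightarrow>
     \<exists>D. ordered_blocks V {..<m} D \<and> coloured_by_Max c D {..<m}"
    using Suc.IH unfolding unavoidable_def by blast
  obtain N where N: "\<And>(V :: nat set) c. \<lbrakk>finite V; N \<le> card V; range c \<subseteq> C\<rbrakk> \<Longrightarrow>
     \<exists>E. ordered_blocks V {..M} E \<and> (\<forall>I\<subseteq>{..M}. M \<in> I \<longrightarrow> c (\<Union>(E ` I)) = c (E M))"
    using unavoidable_dominant_last_block[OF C, of M] unfolding unavoidable_def by blast
  show ?case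
  proof (rule unavoidableI)
    fix V :: "nat set" and c :: "nat set \<Rightarrow> 'c"
    assume V: "finite V" "N \<le> card V" and c: "range c \<subseteq> C"
    obtain E where E: "ordered_blocks V {..M} E"
      and last: "\<And>I. \<lbrakk>I \<subseteq> {..M}; M \<in> I\<rbrakk> \<Longrightarrow> c (\<Union>(E ` I)) = c (E M)"
      using N[OF V c] by blast
    have "range (\<lambda>F. c (\<Union>(E ` F))) \<subseteq> C" using c by auto
    then obtain D where D: "ordered_blocks {..<M} {..<m} D"
      and D_Max: "coloured_by_Max (\<lambda>F. c (\<Union>(E ` F))) D {..<m}"
      using M[of "{..<M}"] by auto
    have D_sub: "D i \<subseteq> {..<M}" if "i < m" for i using ordered_blocksD(3)[OF D] that by simp
    have "ordered_blocks V {..m} (\<lambda>i. \<Union>(E ` (D(m := {M})) i))"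
      using E D by (rule ordered_blocks_UN_append)
    moreover have "c (E M \<union> \<Union>(E ` F)) = c (E M)" if "F \<subseteq> {..<M}" for F
    proof -
      have "insert M F \<subseteq> {..M}" using that by auto
      then show ?thesis using last[of "insert M F"] by simp
    qed
    then have "coloured_by_Max c (\<lambda>i. \<Union>(E ` (D(m := {M})) i)) {..m}"
      using D_Max D_sub by (rule coloured_by_Max_append)
    ultimately show "\<exists>D. ordered_blocks V {..<Suc m} D \<and> coloured_by_Max c D {..<Suc m}"
      unfolding lessThan_Suc_atMost by blast
  qed
qed

lemma obtain_monochromatic_strict_mono:
  fixes f :: "nat \<Rightarrow> 'c"
  assumes "finite C" "range f \<subseteq> C"
  obtains g q where "strict_mono_on {1..k} g" "g ` {1..k} \<subseteq> {..<k * card C}" "q \<in> C"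
    "\<And>i. i \<in> {1..k} \<Longrightarrow> f (g i) = q"
proof -
  let ?J = "{..<k * card C}"
  have "f \<in> ?J \<rightarrow> C" "C \<noteq> {}" using assms(2) by auto
  then obtain q where q: "q \<in> C" "card ?J \<le> card (f -` {q} \<inter> ?J) * card C"
    using pigeonhole_card[of f ?J C] assms(1) by auto
  moreover have "0 < card C" using assms(1) q(1) by (auto simp: card_gt_0_iff)
  ultimately have "k \<le> card (f -` {q} \<inter> ?J)" by simp
  then obtain T where T: "T \<subseteq> f -` {q} \<inter> ?J" "card T = k" "finite T"
    by (meson obtain_subset_with_card_n)
  obtain h where h: "bij_betw h {..<k} T" "strict_mono_on {..<k} h"
    using ex_bij_betw_strict_mono_card[OF T(3)] T(2) by auto
  have h_in: "h (i - 1) \<in> T" if "i \<in> {1..k}" for i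
    using that by (intro bij_betwE[OF h(1), rule_format]) auto
  show ?thesis
  proof
    show "strict_mono_on {1..k} (\<lambda>i. h (i - 1))"
      by (intro strict_mono_onI strict_mono_onD[OF h(2)]) auto
    show "(\<lambda>i. h (i - 1)) ` {1..k} \<subseteq> ?J" "\<And>i. i \<in> {1..k} \<Longrightarrow> f (h (i - 1)) = q"
      using h_in T(1) by blast+
  qed (rule q(1))
qed

theorem unavoidable_monochromatic_unions:
  fixes C :: "'c set" and k :: nat
  assumes C: "finite C"
  shows "unavoidable C (\<lambda>(V :: nat set) c. \<exists>D. \<exists>q\<in>C. ordered_blocks V {1..k} D \<and>
     (\<forall>I\<subseteq>{1..k}. I \<noteq> {} \<longrightarrow> c (\<Union>(D ` I)) = q))"
proof -
  let ?m = "k * card C"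
  obtain N where N: "\<And>(V :: nat set) c. \<lbrakk>finite V; N \<le> card V; range c \<subseteq> C\<rbrakk> \<Longrightarrow>
     \<exists>D. ordered_blocks V {..<?m} D \<and> coloured_by_Max c D {..<?m}"
    using unavoidable_coloured_by_Max[OF C, of ?m] unfolding unavoidable_def by blast
  show ?thesis
  proof (rule unavoidableI)
    fix V :: "nat set" and c :: "nat set \<Rightarrow> 'c"
    assume V: "finite V" "N \<le> card V" and c: "range c \<subseteq> C"
    obtain D where D: "ordered_blocks V {..<?m} D" and D_Max: "coloured_by_Max c D {..<?m}"
      using N[OF V c] by blast
    have "range (\<lambda>n. c (D n)) \<subseteq> C" using c by auto
    then obtain g q where g: "strict_mono_on {1..k} g" "g ` {1..k} \<subseteq> {..<?m}" and q: "q \<in> C"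
      and colour: "\<And>i. i \<in> {1..k} \<Longrightarrow> c (D (g i)) = q"
      using obtain_monochromatic_strict_mono[OF C] by metis
    have "c (\<Union>i\<in>I. D (g i)) = q" if I: "I \<subseteq> {1..k}" "I \<noteq> {}" for I
    proof -
      have "g ` I \<subseteq> {..<?m}" "g ` I \<noteq> {}" using g(2) I by auto
      then have "c (\<Union>(D ` g ` I)) = c (D (Max (g ` I)))"
        using D_Max unfolding coloured_by_Max_def by blast
      moreover have "Max (g ` I) \<in> g ` I" using I by (intro Max_in) (auto intro: finite_subset)
      ultimately show ?thesis using colour I(1) by (auto simp: image_image)
    qed
    moreover have "ordered_blocks V {1..k} (\<lambda>i. D (g i))"
      using D g by (rule ordered_blocks_reindex)
    ultimately show "\<exists>D. \<exists>q\<in>C. ordered_blocks V {1..k} D \<and>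
        (\<forall>I\<subseteq>{1..k}. I \<noteq> {} \<longrightarrow> c (\<Union>(D ` I)) = q)"
      using q by blast
  qed
qed

section \<open>Sums over blocks\<close>

lemma ordered_sum_singleton [simp]: "ordered_sum x {t} = x t"
  by (simp add: ordered_sum_def)

lemma foldl_add_assoc:
  "foldl (\<lambda>s t. s + x t) (a + b) ts = a + foldl (\<lambda>s t. s + x t) (b :: 'a::semigroup_add) ts"
  by (induction ts arbitrary: b) (auto simp: add.assoc)

lemma ordered_sum_Un:
  assumes "finite F" "F \<noteq> {}" "finite G" "G \<noteq> {}" and less: "\<And>a b. a \<in> F \<Longrightarrow> b \<in> G \<Longrightarrow> a < b"
  shows "ordered_sum x (F \<union> G) = ordered_sum x F + ordered_sum x G"
proof -
  have append: "sorted_list_of_set (F \<union> G) = sorted_list_of_set F @ sorted_list_of_set G"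
    using assms
    by (intro sorted_distinct_set_unique) (auto simp: sorted_append intro: less_imp_le dest: less)
  obtain f fs where F: "sorted_list_of_set F = f # fs"
    using assms by (cases "sorted_list_of_set F") auto
  obtain g gs where G: "sorted_list_of_set G = g # gs"
    using assms by (cases "sorted_list_of_set G") auto
  show ?thesis by (simp add: ordered_sum_def append F G foldl_add_assoc)
qed

lemma ordered_sum_UN:
  assumes D: "ordered_blocks V K D" and "I \<subseteq> K" "finite I" "I \<noteq> {}"
  shows "ordered_sum x (\<Union>(D ` I)) = ordered_sum (\<lambda>i. ordered_sum x (D i)) I"
  using assms(3,2,4)
proof (induction I rule: finite_linorder_max_induct)
  case empty
  then show ?case by simp
next
  case (insert m I)
  let ?y = "\<lambda>i. ordered_sum x (D i)"
  have I: "I \<subseteq> K" and m: "m \<in> K" using insert.prems(1) by auto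
  show ?case
  proof (cases "I = {}")
    case True
    then show ?thesis by simp
  next
    case False
    have "ordered_sum x (\<Union>(D ` I) \<union> D m) = ordered_sum x (\<Union>(D ` I)) + ?y m"
    proof (rule ordered_sum_Un)
      show "finite (\<Union>(D ` I))" using insert.hyps(1) ordered_blocksD(1)[OF D] I by blast
      show "\<Union>(D ` I) \<noteq> {}" using D I False by (rule ordered_blocks_UN_nonempty)
      show "a < b" if "a \<in> \<Union>(D ` I)" "b \<in> D m" for a b
        using that insert.hyps(2) ordered_blocks_less[OF D] I m by blast
    qed (use ordered_blocksD[OF D m] in simp_all)
    also have "\<dots> = ordered_sum ?y I + ordered_sum ?y {m}"
      using insert.IH[OF I False] by simp
    also have "\<dots> = ordered_sum ?y (I \<union> {m})"
      using insert.hyps False by (intro ordered_sum_Un[symmetric]) auto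
    finally show ?thesis by (simp add: Un_commute)
  qed
qed

section \<open>Summable sets\<close>

lemma k_summable_le:
  assumes "k_summable k A" "l \<le> k"
  shows "k_summable l A"
proof -
  have "{1..l} \<subseteq> {1..k}" using assms(2) by auto
  then show ?thesis
    using assms(1) unfolding k_summable_def unique_finite_sums_def by (meson subset_trans)
qed

lemma unique_finite_sums_blocks:
  assumes x: "unique_finite_sums n x" and D: "ordered_blocks {1..n} {1..k} D"
  shows "unique_finite_sums k (\<lambda>i. ordered_sum x (D i))"
  unfolding unique_finite_sums_def
proof (intro allI impI)
  fix F H
  assume F: "F \<noteq> {}" "F \<subseteq> {1..k}" and H: "H \<noteq> {}" "H \<subseteq> {1..k}"
    and eq: "ordered_sum (\<lambda>i. ordered_sum x (D i)) F = ordered_sum (\<lambda>i. ordered_sum x (D i)) H"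
  note nonempty = ordered_blocks_UN_nonempty[OF D]
  note subset = ordered_blocks_UN_subset[OF D]
  have "finite F" "finite H" using F(2) H(2) by (auto intro: finite_subset)
  then have "ordered_sum x (\<Union>(D ` F)) = ordered_sum x (\<Union>(D ` H))"
    using ordered_sum_UN[OF D F(2) _ F(1), of x] ordered_sum_UN[OF D H(2) _ H(1), of x] eq by simp
  then have "\<Union>(D ` F) = \<Union>(D ` H)"
    by (rule x[unfolded unique_finite_sums_def, rule_format,
          OF nonempty[OF F(2,1)] subset[OF F(2)] nonempty[OF H(2,1)] subset[OF H(2)]])
  then show "F = H" by (rule ordered_blocks_UN_inject[OF D F(2) H(2)])
qed

lemma k_summable_blocks:
  assumes x: "unique_finite_sums n x" and D: "ordered_blocks {1..n} {1..k} D"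
    and A: "\<And>I. \<lbrakk>I \<subseteq> {1..k}; I \<noteq> {}\<rbrakk> \<Longrightarrow> ordered_sum x (\<Union>(D ` I)) \<in> A"
  shows "k_summable k A"
  unfolding k_summable_def
proof (intro exI conjI allI impI)
  show "unique_finite_sums k (\<lambda>i. ordered_sum x (D i))"
    using x D by (rule unique_finite_sums_blocks)
  fix I assume I: "I \<noteq> {}" "I \<subseteq> {1..k}"
  have "finite I" using I(2) by (rule finite_subset) simp
  then show "ordered_sum (\<lambda>i. ordered_sum x (D i)) I \<in> A"
    using ordered_sum_UN[OF D I(2) _ I(1), of x] A[OF I(2,1)] by simp
qed

lemma k_summable_UN:
  assumes I: "finite (I :: 'i set)"
  shows "\<exists>n\<ge>1. \<forall>B :: 'i \<Rightarrow> 'a::semigroup_add set.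
    k_summable n (\<Union>i\<in>I. B i) \<longrightarrow> (\<exists>i\<in>I. k_summable k (B i))"
proof -
  obtain N where N: "\<And>(V :: nat set) c. \<lbrakk>finite V; N \<le> card V; range c \<subseteq> I\<rbrakk> \<Longrightarrow>
     \<exists>D. \<exists>q\<in>I. ordered_blocks V {1..k} D \<and> (\<forall>J\<subseteq>{1..k}. J \<noteq> {} \<longrightarrow> c (\<Union>(D ` J)) = q)"
    using unavoidable_monochromatic_unions[OF I, of k] unfolding unavoidable_def by blast
  let ?n = "Suc N"
  have "\<exists>i\<in>I. k_summable k (B i)" if summable: "k_summable ?n (\<Union>i\<in>I. B i)"
    for B :: "'i \<Rightarrow> 'a set"
  proof -
    obtain x where x: "unique_finite_sums ?n x"
      and sums: "\<And>F. \<lbrakk>F \<noteq> {}; F \<subseteq> {1..?n}\<rbrakk> \<Longrightarrow> ordered_sum x F \<in> (\<Union>i\<in>I. B i)"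
      using summable unfolding k_summable_def by blast
    have "I \<noteq> {}" using sums[of "{1}"] by auto
    then have "\<forall>F. \<exists>i\<in>I. F \<noteq> {} \<longrightarrow> F \<subseteq> {1..?n} \<longrightarrow> ordered_sum x F \<in> B i"
      using sums by blast
    then obtain c where c: "range c \<subseteq> I"
      and c_B: "\<And>F. \<lbrakk>F \<noteq> {}; F \<subseteq> {1..?n}\<rbrakk> \<Longrightarrow> ordered_sum x F \<in> B (c F)"
      by (metis image_subsetI)
    obtain D q where q: "q \<in> I" and D: "ordered_blocks {1..?n} {1..k} D"
      and D_mono: "\<And>J. \<lbrakk>J \<subseteq> {1..k}; J \<noteq> {}\<rbrakk> \<Longrightarrow> c (\<Union>(D ` J)) = q"
      using N[OF _ _ c, of "{1..?n}"] by auto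
    have "k_summable k (B q)"
    proof (rule k_summable_blocks[OF x D])
      fix J assume J: "J \<subseteq> {1..k}" "J \<noteq> {}"
      have "\<Union>(D ` J) \<noteq> {}" using D J by (rule ordered_blocks_UN_nonempty)
      moreover have "\<Union>(D ` J) \<subseteq> {1..?n}" using D J(1) by (rule ordered_blocks_UN_subset)
      ultimately show "ordered_sum x (\<Union>(D ` J)) \<in> B q" using c_B D_mono[OF J] by metis
    qed
    then show ?thesis using q by blast
  qed
  then show ?thesis by (intro exI[of _ ?n]) simp
qed

lemma finite_FS_big_UN:
  assumes I: "finite I" and big: "finite_FS_big (\<Union>i\<in>I. B i)"
  shows "\<exists>i\<in>I. finite_FS_big (B i)"
proof (rule ccontr)
  assume "\<not> ?thesis"
  then obtain \<kappa> where \<kappa>: "\<And>i. i \<in> I \<Longrightarrow> \<not> k_summable (\<kappa> i) (B i)"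
    unfolding finite_FS_big_def by metis
  obtain i where i: "i \<in> I" "k_summable (sum \<kappa> I) (B i)"
    using k_summable_UN[OF I] big unfolding finite_FS_big_def by metis
  then have "k_summable (\<kappa> i) (B i)"
    using k_summable_le member_le_sum[of i I \<kappa>] I by blast
  then show False using \<kappa> i(1) by blast
qed

theorem theorem4:
  "partition_regular {A :: 'a::semigroup_add set. finite_FS_big A} \<and>
   (\<forall>(A :: 'a set) (r :: nat) (B :: nat \<Rightarrow> 'a set).
      finite_FS_big A \<longrightarrow> 1 \<le> r \<longrightarrow> A = (\<Union>i\<in>{1..r}. B i) \<longrightarrow>
      (\<exists>i\<in>{1..r}. finite_FS_big (B i)))"
proof (intro conjI allI impI)
  show "partition_regular {A :: 'a set. finite_FS_big A}"
    unfolding partition_regular_def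
  proof (intro ballI allI impI)
    fix A :: "'a set" and P
    assume "A \<in> {A. finite_FS_big A}" "finite P" "partition_on A P"
    then show "\<exists>B\<in>P. B \<in> {A. finite_FS_big A}"
      using finite_FS_big_UN[of P "\<lambda>B. B"] by (simp add: partition_on_def)
  qed
qed (use finite_FS_big_UN in blast)

end
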